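(* For all $n\in\mathbb{N}$ with $n\ge 3$ and all real $\alpha\ge 2$, the best constant $c_n(\alpha)$ in the Markov inequality $\|p'\|_{w_\alpha}\le c_n(\alpha)\|p\|_{w_\alpha}$, $p\in\mathcal{P}_n$, satisfies $$[c_n(\alpha)]^2\le \frac{4(n+1)\left(n+3+\frac{3(\alpha+1)}{4}\right)}{\alpha^2+10\alpha+8}.$$
   Context: For real $\alpha>-1$ let $w_\alpha(t)=t^\alpha e^{-t}$, $t>0$, be the Laguerre weight and $\|f\|_{w_\alpha}=\left(\int_0^\infty |f(x)|^2 w_\alpha(x)\,dx\right)^{1/2}$. $\mathcal{P}_n$ is the set of algebraic polynomials (real coefficients) of degree at most $n$. The best Markov constant is $c_n(\alpha)=\sup_{p\in\mathcal{P}_n,\,p\ne 0}\|p'\|_{w_\alpha}/\|p\|_{w_\alpha}$. *)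

theory Defs
  imports "HOL-Analysis.Analysis" "HOL-Computational_Algebra.Polynomial"
begin

definition laguerre_weight :: "real \<Rightarrow> real \<Rightarrow> real" where
  "laguerre_weight \<alpha> t = t powr \<alpha> * exp (- t)"

definition laguerre_norm :: "real \<Rightarrow> (real \<Rightarrow> real) \<Rightarrow> real" where
  "laguerre_norm \<alpha> f =
     sqrt (LINT x:{0<..}|lborel. \<bar>f x\<bar>\<^sup>2 * laguerre_weight \<alpha> x)"

text \<open>
  The supremum is taken in the extended reals, so that an upper bound on it also asserts
  that the set of quotients is bounded.
\<close>

definition markov_constant :: "nat \<Rightarrow> real \<Rightarrow> ereal" where
  "markov_constant n \<alpha> =
     (SUP p\<in>{p :: real poly. degree p \<le> n \<and> p \<noteq> 0}.
        ereal (laguerre_norm \<alpha> (poly (pderiv p)) / laguerre_norm \<alpha> (poly p)))"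

text \<open>
  The following two facts show that the totalised operations in these definitions (the integral of
  a non-integrable function and division by zero) never take their default values for polynomials.
\<close>

lemma set_integrable_power_laguerre_weight:
  assumes "\<alpha> > -1"
  shows "set_integrable lborel {0<..} (\<lambda>x. x ^ k * laguerre_weight \<alpha> x)"
proof -
  have "((\<lambda>t. t powr ((\<alpha> + k + 1) - 1) / exp t) has_integral Gamma (\<alpha> + k + 1)) {0..}"
    using assms by (intro Gamma_integral_real) auto
  then have "(\<lambda>t. t powr (\<alpha> + k) / exp t) integrable_on {0..}"
    by (simp add: integrable_on_def) blast
  then have "(\<lambda>t. t powr (\<alpha> + k) / exp t) integrable_on {0<..}"
    by (rule integrable_spike_set) (auto intro: negligible_subset[of "{0}"])
  then have "(\<lambda>t. t powr (\<alpha> + k) / exp t) absolutely_integrable_on {0<..}"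
    by (intro nonnegative_absolutely_integrable_1) auto
  then have "set_integrable lebesgue {0<..} (\<lambda>x. x ^ k * laguerre_weight \<alpha> x)"
    by (rule set_integrable_cong[THEN iffD1, rotated -1])
       (auto simp: laguerre_weight_def powr_add powr_realpow exp_minus field_simps)
  moreover have "(\<lambda>x. indicator {0<..} x *\<^sub>R (x ^ k * laguerre_weight \<alpha> x)) \<in> borel_measurable lborel"
    unfolding laguerre_weight_def by measurable
  ultimately show ?thesis
    unfolding set_integrable_def using integrable_completion by blast
qed

lemma set_integrable_poly_laguerre_weight:
  assumes "\<alpha> > -1"
  shows "set_integrable lborel {0<..} (\<lambda>x. \<bar>poly p x\<bar>\<^sup>2 * laguerre_weight \<alpha> x)"
proof -
  have "(\<lambda>x. \<bar>poly p x\<bar>\<^sup>2 * laguerre_weight \<alpha> x) =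
        (\<lambda>x. \<Sum>k\<le>degree (p ^ 2). coeff (p ^ 2) k * (x ^ k * laguerre_weight \<alpha> x))"
    by (simp add: poly_altdef[of "p ^ 2"] sum_distrib_right mult.assoc flip: poly_power)
  moreover have "set_integrable lborel {0<..}
      (\<lambda>x. coeff (p ^ 2) k * (x ^ k * laguerre_weight \<alpha> x))" for k
    using set_integrable_power_laguerre_weight[OF assms] by (rule set_integrable_mult_right)
  ultimately show ?thesis
    by (simp only: set_integrable_def scaleR_sum_right Bochner_Integration.integrable_sum)
qed

lemma laguerre_norm_poly_pos:
  assumes "\<alpha> > -1" "p \<noteq> 0"
  shows "laguerre_norm \<alpha> (poly p) > 0"
proof -
  let ?g = "\<lambda>x. indicator {0<..} x *\<^sub>R (\<bar>poly p x\<bar>\<^sup>2 * laguerre_weight \<alpha> x) :: real"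
  have nn: "?g x \<ge> 0" for x
    by (simp add: laguerre_weight_def)
  have int: "integrable lborel ?g"
    using set_integrable_poly_laguerre_weight[OF assms(1)] by (simp add: set_integrable_def)
  have "integral\<^sup>L lborel ?g \<noteq> 0"
  proof
    assume "integral\<^sup>L lborel ?g = 0"
    then have "AE x in lborel. ?g x = 0"
      using integral_nonneg_eq_0_iff_AE[OF int] nn by simp
    moreover have "AE x in lborel. x \<notin> {x. poly p x = 0}"
      using poly_roots_finite[OF assms(2)]
      by (intro AE_not_in) (simp add: finite_imp_null_set_lborel)
    ultimately have "AE x in lborel. x \<notin> {0<..<1::real}"
      by eventually_elim (auto simp: laguerre_weight_def indicator_def)
    then have "{0<..<1::real} \<in> null_sets lborel"
      by (simp add: AE_iff_null_sets)
    then show False by (simp add: null_sets_def)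
  qed
  moreover have "integral\<^sup>L lborel ?g \<ge> 0"
    using nn by (intro Bochner_Integration.integral_nonneg) auto
  ultimately show ?thesis
    by (simp add: laguerre_norm_def set_lebesgue_integral_def)
qed

end

theory Submission
  imports Defs
begin

text \<open>
  Write \<open>p = \<Sum>\<^sub>k c\<^sub>k L\<^sub>k\<close> in the Laguerre polynomials, which are orthogonal for \<open>w\<^sub>\<alpha>\<close>, and
  let \<open>h\<^sub>k = \<parallel>L\<^sub>k\<parallel>\<^sup>2\<close>. Since \<open>L\<^sub>k' = - \<Sum>\<^bsub>j<k\<^esub> L\<^sub>j\<close>, the coefficients of \<open>p'\<close> are, up to sign,
  the tails \<open>s\<^sub>j = \<Sum>\<^bsub>k>j\<^esub> c\<^sub>k\<close>, and \<open>c\<^bsub>j+1\<^esub> = s\<^sub>j - s\<^bsub>j+1\<^esub>\<close>. The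
  coefficient \<open>c\<^sub>0\<close> only increases \<open>\<parallel>p\<parallel>\<close>, so a bound \<open>\<parallel>p'\<parallel>\<^sup>2 \<le> \<mu>\<^sup>-\<^sup>1 \<parallel>p\<parallel>\<^sup>2\<close> is the discrete Hardy inequality
  \<open>\<mu> \<Sum> h\<^sub>j s\<^sub>j\<^sup>2 \<le> \<Sum> h\<^bsub>j+1\<^esub> (s\<^sub>j - s\<^bsub>j+1\<^esub>)\<^sup>2\<close> for sequences with \<open>s\<^sub>n = 0\<close>, that is,
  a lower bound for the smallest eigenvalue of a Jacobi matrix. Such a bound follows from any
  supersolution \<open>u\<close>, a sequence positive below \<open>n\<close> with
  \<open>h\<^bsub>j+1\<^esub> (u\<^sub>j - u\<^bsub>j+1\<^esub>) - h\<^sub>j (u\<^bsub>j-1\<^esub> - u\<^sub>j) \<ge> \<mu> h\<^sub>j u\<^sub>j\<close>; this is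
  \<open>weighted_discrete_hardy\<close>, phrased in the ratios \<open>t\<^sub>j = u\<^sub>j / u\<^bsub>j-1\<^esub>\<close>.

  The supersolution comes from the limit of large \<open>n\<close>. As \<open>h\<^bsub>j+1\<^esub> / h\<^sub>j = 1 + \<alpha> / (j + 1)\<close>,
  rescaling \<open>j = n x\<close> turns the condition into \<open>- (x\<^sup>\<alpha> u')' \<ge> \<lambda> x\<^sup>\<alpha> u\<close> on \<open>(0, 1)\<close> with
  \<open>\<lambda> = n\<^sup>2 \<mu>\<close>. With \<open>b = \<alpha> + 1\<close>, the function \<open>u = (1 - x\<^sup>2) exp (- b x\<^sup>2 / 4)\<close> satisfies
  \<open>- (x\<^sup>\<alpha> u')' = (2 b + b\<^sup>2 / 2 - b\<^sup>2 x\<^sup>2 / 4) x\<^sup>\<alpha> u\<close>, so \<open>\<lambda> = b (b + 8) / 4\<close> is attained; the factor in the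
  exponent is the one for which the boundary zero at \<open>x = 1\<close> cancels. The claimed bound
  has \<open>b (b + 8) - 1 = \<alpha>\<^sup>2 + 10 \<alpha> + 8\<close> in place of \<open>b (b + 8)\<close>, and lower order terms in \<open>n\<close>, which
  leave room for a discretisation with rational ratios
  (\<open>supersolution_ratio\<close>). After clearing denominators, the condition at \<open>j\<close> is that a polynomial
  in \<open>j\<close>, \<open>n - 1 - j\<close> and \<open>b\<close> is nonnegative, and all of its coefficients are nonnegative.
\<close>

section \<open>Integration of polynomials against the Laguerre weight\<close>

definition laguerre_integral :: "real \<Rightarrow> real poly \<Rightarrow> real" where
  "laguerre_integral \<alpha> p = (LINT x:{0<..}|lborel. poly p x * laguerre_weight \<alpha> x)"

lemma set_integrable_poly_weight:
  assumes "\<alpha> > -1"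
  shows "set_integrable lborel {0<..} (\<lambda>x. poly p x * laguerre_weight \<alpha> x)"
proof -
  have "(\<lambda>x. poly p x * laguerre_weight \<alpha> x) =
        (\<lambda>x. \<Sum>k\<le>degree p. coeff p k * (x ^ k * laguerre_weight \<alpha> x))"
    by (simp add: poly_altdef sum_distrib_right mult.assoc)
  moreover have "set_integrable lborel {0<..} (\<lambda>x. coeff p k * (x ^ k * laguerre_weight \<alpha> x))" for k
    using set_integrable_power_laguerre_weight[OF assms] by (rule set_integrable_mult_right)
  ultimately show ?thesis
    by (simp only: set_integrable_def scaleR_sum_right Bochner_Integration.integrable_sum)
qed

lemma laguerre_integral_add:
  assumes "\<alpha> > -1"
  shows "laguerre_integral \<alpha> (p + q) = laguerre_integral \<alpha> p + laguerre_integral \<alpha> q"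
  unfolding laguerre_integral_def
  using set_integral_add(2)[OF set_integrable_poly_weight[OF assms, of p]
      set_integrable_poly_weight[OF assms, of q]]
  by (simp add: distrib_right)

lemma laguerre_integral_smult:
  "laguerre_integral \<alpha> (smult c p) = c * laguerre_integral \<alpha> p"
  unfolding laguerre_integral_def by (simp add: mult.assoc)

lemma laguerre_integral_0 [simp]: "laguerre_integral \<alpha> 0 = 0"
  by (simp add: laguerre_integral_def)

lemma laguerre_integral_minus: "laguerre_integral \<alpha> (- p) = - laguerre_integral \<alpha> p"
  using laguerre_integral_smult[of \<alpha> "-1" p] by simp

lemma laguerre_integral_diff:
  assumes "\<alpha> > -1"
  shows "laguerre_integral \<alpha> (p - q) = laguerre_integral \<alpha> p - laguerre_integral \<alpha> q"
  using laguerre_integral_add[OF assms, of p "- q"] by (simp add: laguerre_integral_minus)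

lemma laguerre_integral_sum:
  assumes "\<alpha> > -1"
  shows "laguerre_integral \<alpha> (\<Sum>i\<in>A. f i) = (\<Sum>i\<in>A. laguerre_integral \<alpha> (f i))"
  by (induction A rule: infinite_finite_induct) (simp_all add: laguerre_integral_add[OF assms])

lemma laguerre_norm_poly:
  "(laguerre_norm \<alpha> (poly p))\<^sup>2 = laguerre_integral \<alpha> (p\<^sup>2)"
proof -
  have "0 \<le> (LINT x:{0<..}|lborel. \<bar>poly p x\<bar>\<^sup>2 * laguerre_weight \<alpha> x)"
    unfolding set_lebesgue_integral_def
    by (intro Bochner_Integration.integral_nonneg) (simp add: laguerre_weight_def)
  then show ?thesis
    by (simp add: laguerre_norm_def laguerre_integral_def)
qed

lemma laguerre_integral_monom:
  assumes "\<alpha> > -1"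
  shows "laguerre_integral \<alpha> (monom 1 k) = Gamma (\<alpha> + real k + 1)"
proof -
  have "((\<lambda>t. t powr ((\<alpha> + k + 1) - 1) / exp t) has_integral Gamma (\<alpha> + k + 1)) {0..}"
    using assms by (intro Gamma_integral_real) auto
  then have "((\<lambda>t. t powr (\<alpha> + k) / exp t) has_integral Gamma (\<alpha> + k + 1)) {0<..}"
    by (subst (asm) has_integral_spike_set_eq[where T = "{0<..}"])
       (auto intro: negligible_subset[of "{0}"])
  then have "((\<lambda>x. x ^ k * laguerre_weight \<alpha> x) has_integral Gamma (\<alpha> + k + 1)) {0<..}"
    by (rule has_integral_eq[rotated])
       (auto simp: laguerre_weight_def powr_add powr_realpow exp_minus field_simps)
  then show ?thesis
    using set_borel_integral_eq_integral(2)[OF set_integrable_power_laguerre_weight[OF assms, of k]]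
    by (simp add: laguerre_integral_def poly_monom integral_unique)
qed

text \<open>
  This is integration by parts: \<open>(x p' + (\<alpha> + 1 - x) p) w\<^sub>\<alpha>\<close> is the derivative of
  \<open>x p w\<^sub>\<alpha>\<close>, which vanishes at both ends of the half-line. On monomials it is the functional
  equation of the Gamma function.
\<close>

lemma laguerre_integral_by_parts:
  assumes "\<alpha> > -1"
  shows "laguerre_integral \<alpha> ([:0, 1:] * pderiv p + [:\<alpha> + 1, -1:] * p) = 0"
proof -
  define \<Phi> where "\<Phi> q = [:0, 1:] * pderiv q + [:\<alpha> + 1, -1:] * q" for q :: "real poly"
  have add: "\<Phi> (q + r) = \<Phi> q + \<Phi> r" for q r
    by (simp add: \<Phi>_def pderiv_add distrib_left del: mult_pCons_left)
  have monom: "laguerre_integral \<alpha> (\<Phi> (monom c k)) = 0" for c k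
  proof -
    have "\<Phi> (monom c k) =
        smult (c * (\<alpha> + real k + 1)) (monom 1 k) - smult c (monom 1 (Suc k))"
    proof (rule poly_eq_poly_eq_iff[THEN iffD1])
      show "poly (\<Phi> (monom c k)) =
          poly (smult (c * (\<alpha> + real k + 1)) (monom 1 k) - smult c (monom 1 (Suc k)))"
        by (rule ext, cases k) (simp_all add: \<Phi>_def pderiv_monom poly_monom algebra_simps)
    qed
    moreover have "Gamma (\<alpha> + real (Suc k) + 1) = (\<alpha> + real k + 1) * Gamma (\<alpha> + real k + 1)"
      using Gamma_plus1[of "\<alpha> + real k + 1"] assms nonpos_Ints_nonpos[of "\<alpha> + real k + 1"]
      by (force simp: add_ac)
    ultimately show ?thesis
      by (simp add: laguerre_integral_diff laguerre_integral_smult laguerre_integral_monom assms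
          del: of_nat_Suc)
  qed
  have "laguerre_integral \<alpha> (\<Phi> (\<Sum>i\<le>m. monom (coeff p i) i)) = 0" for m
    by (induction m) (simp_all add: add monom laguerre_integral_add assms)
  from this[of "degree p"] show ?thesis
    by (simp add: poly_as_sum_of_monoms \<Phi>_def)
qed

section \<open>Laguerre polynomials\<close>

text \<open>
  Of the usual definitions, the one-step raising recursion is chosen because it is stated in
  terms of a derivative: differentiating it yields the differential equation and the derivative
  formula by one induction, without the three-term recurrence.
\<close>

primrec laguerre_poly :: "real \<Rightarrow> nat \<Rightarrow> real poly" where
  "laguerre_poly \<alpha> 0 = 1"
| "laguerre_poly \<alpha> (Suc k) = smult (1 / (real k + 1))
     ([:0, 1:] * pderiv (laguerre_poly \<alpha> k) + [:real k + 1 + \<alpha>, -1:] * laguerre_poly \<alpha> k)"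

lemma laguerre_poly_raising:
  "smult (real k + 1) (laguerre_poly \<alpha> (Suc k)) =
     [:0, 1:] * pderiv (laguerre_poly \<alpha> k) + [:real k + 1 + \<alpha>, -1:] * laguerre_poly \<alpha> k"
  by (simp del: mult_pCons_left)

text \<open>
  The Laguerre polynomials are the eigenvectors of this operator, which is symmetric because
  \<open>w\<^sub>\<alpha>\<close> times its value at \<open>p\<close> is the derivative of \<open>x w\<^sub>\<alpha> p'\<close>.
\<close>

definition laguerre_operator :: "real \<Rightarrow> real poly \<Rightarrow> real poly" where
  "laguerre_operator \<alpha> p = [:0, 1:] * pderiv (pderiv p) + [:\<alpha> + 1, -1:] * pderiv p"

text \<open>
  Differentiating the raising recursion produces \<open>x L''\<close>, which the differential equation for
  the same index eliminates. The equation appears as a hypothesis because it is itself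
  proved by an induction whose step uses this derivative formula.
\<close>

lemma pderiv_laguerre_poly_Suc_if_eigen:
  assumes "laguerre_operator \<alpha> (laguerre_poly \<alpha> k) = smult (- real k) (laguerre_poly \<alpha> k)"
  shows "pderiv (laguerre_poly \<alpha> (Suc k)) = pderiv (laguerre_poly \<alpha> k) - laguerre_poly \<alpha> k"
proof (rule poly_eq_poly_eq_iff[THEN iffD1], rule ext)
  fix x
  let ?L = "laguerre_poly \<alpha> k"
  have "poly (laguerre_operator \<alpha> ?L) x = - real k * poly ?L x"
    by (simp add: assms)
  then have ode: "x * poly (pderiv (pderiv ?L)) x =
      - (\<alpha> + 1 - x) * poly (pderiv ?L) x - real k * poly ?L x"
    by (simp add: laguerre_operator_def algebra_simps)
  have "(real k + 1) * poly (pderiv (laguerre_poly \<alpha> (Suc k))) x =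
      poly (pderiv (smult (real k + 1) (laguerre_poly \<alpha> (Suc k)))) x"
    by (simp add: pderiv_smult del: laguerre_poly.simps)
  also have "\<dots> = x * poly (pderiv (pderiv ?L)) x + (real k + 2 + \<alpha> - x) * poly (pderiv ?L) x - poly ?L x"
    unfolding laguerre_poly_raising
    by (simp add: pderiv_add pderiv_mult pderiv_pCons pderiv_smult pderiv_minus algebra_simps)
  also have "\<dots> = (real k + 1) * (poly (pderiv ?L) x - poly ?L x)"
    unfolding ode by (simp add: algebra_simps)
  finally show "poly (pderiv (laguerre_poly \<alpha> (Suc k))) x = poly (pderiv ?L - ?L) x"
    by (simp add: add_nonneg_eq_0_iff del: laguerre_poly.simps)
qed

lemma laguerre_operator_eigen:
  "laguerre_operator \<alpha> (laguerre_poly \<alpha> k) = smult (- real k) (laguerre_poly \<alpha> k)"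
proof (induction k)
  case 0
  then show ?case by (simp add: laguerre_operator_def)
next
  case (Suc k)
  let ?L = "laguerre_poly \<alpha> k" and ?M = "laguerre_poly \<alpha> (Suc k)"
  note d = pderiv_laguerre_poly_Suc_if_eigen[OF Suc.IH]
  show ?case
  proof (rule poly_eq_poly_eq_iff[THEN iffD1], rule ext)
    fix x
    have "poly (laguerre_operator \<alpha> ?L) x = - real k * poly ?L x"
      by (simp add: Suc.IH)
    then have ode: "x * poly (pderiv (pderiv ?L)) x =
        - (\<alpha> + 1 - x) * poly (pderiv ?L) x - real k * poly ?L x"
      by (simp add: laguerre_operator_def algebra_simps)
    have M: "(real k + 1) * poly ?M x =
        x * poly (pderiv ?L) x + (real k + 1 + \<alpha> - x) * poly ?L x"
      using arg_cong[OF laguerre_poly_raising[of k \<alpha>], of "\<lambda>p. poly p x"]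
      by (simp add: algebra_simps del: laguerre_poly.simps)
    have "poly (laguerre_operator \<alpha> ?M) x = x * poly (pderiv (pderiv ?L)) x
        - x * poly (pderiv ?L) x + (\<alpha> + 1 - x) * (poly (pderiv ?L) x - poly ?L x)"
      unfolding laguerre_operator_def d by (simp add: pderiv_diff d algebra_simps)
    also have "\<dots> = - ((real k + 1) * poly ?M x)"
      unfolding ode M by (simp add: algebra_simps)
    finally show "poly (laguerre_operator \<alpha> ?M) x = poly (smult (- real (Suc k)) ?M) x"
      by (simp del: laguerre_poly.simps add: algebra_simps)
  qed
qed

lemmas pderiv_laguerre_poly_Suc =
  pderiv_laguerre_poly_Suc_if_eigen[OF laguerre_operator_eigen]

lemma pderiv_laguerre_poly:
  "pderiv (laguerre_poly \<alpha> k) = - (\<Sum>j<k. laguerre_poly \<alpha> j)"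
  by (induction k) (simp_all add: pderiv_laguerre_poly_Suc del: laguerre_poly.simps(2))

lemma laguerre_poly_lowering:
  "[:0, 1:] * pderiv (laguerre_poly \<alpha> (Suc k)) =
     smult (real k + 1) (laguerre_poly \<alpha> (Suc k)) - smult (real k + 1 + \<alpha>) (laguerre_poly \<alpha> k)"
  unfolding pderiv_laguerre_poly_Suc laguerre_poly_raising
  by (rule poly_eq_poly_eq_iff[THEN iffD1], rule ext) (simp add: algebra_simps)

lemma degree_laguerre_poly: "degree (laguerre_poly \<alpha> k) = k"
  and coeff_laguerre_poly_nz: "coeff (laguerre_poly \<alpha> k) k \<noteq> 0"
proof -
  have "degree (laguerre_poly \<alpha> k) \<le> k \<and> coeff (laguerre_poly \<alpha> k) k \<noteq> 0"
  proof (induction k)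
    case 0
    then show ?case by simp
  next
    case (Suc k)
    let ?L = "laguerre_poly \<alpha> k"
    have "coeff (laguerre_poly \<alpha> (Suc k)) i = 1 / (real k + 1) *
        ((real i + real k + 1 + \<alpha>) * coeff ?L i - (if i = 0 then 0 else coeff ?L (i - 1)))" for i
      by (cases i) (simp_all add: coeff_pCons coeff_pderiv algebra_simps)
    moreover have "coeff ?L i = 0" if "i > k" for i
      using Suc.IH that by (intro coeff_eq_0) auto
    ultimately show ?case
      using Suc.IH by (auto intro!: degree_le simp del: laguerre_poly.simps)
  qed
  then show "degree (laguerre_poly \<alpha> k) = k" "coeff (laguerre_poly \<alpha> k) k \<noteq> 0"
    using le_degree[of "laguerre_poly \<alpha> k" k] by auto
qed

lemma laguerre_expansion:
  assumes "degree p \<le> n"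
  shows "\<exists>c. p = (\<Sum>k\<le>n. smult (c k) (laguerre_poly \<alpha> k))"
  using assms
proof (induction n arbitrary: p)
  case 0
  then obtain a where "p = [:a:]"
    using degree_eq_zeroE by blast
  then show ?case by (intro exI[of _ "\<lambda>_. a"]) simp
next
  case (Suc n)
  let ?L = "laguerre_poly \<alpha> (Suc n)"
  define a where "a = coeff p (Suc n) / coeff ?L (Suc n)"
  have "degree (p - smult a ?L) \<le> Suc n"
    using Suc.prems degree_laguerre_poly[of \<alpha> "Suc n"]
    by (intro degree_diff_le) (auto simp del: laguerre_poly.simps)
  moreover have "coeff (p - smult a ?L) (Suc n) = 0"
    using coeff_laguerre_poly_nz[of \<alpha> "Suc n"] by (simp add: a_def del: laguerre_poly.simps)
  ultimately have "degree (p - smult a ?L) \<le> n"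
    by (metis le_Suc_eq leading_coeff_0_iff degree_0 le0)
  from Suc.IH[OF this] obtain c
    where c: "p - smult a ?L = (\<Sum>k\<le>n. smult (c k) (laguerre_poly \<alpha> k))" by blast
  have "p = (\<Sum>k\<le>Suc n. smult ((c(Suc n := a)) k) (laguerre_poly \<alpha> k))"
    using c by (simp add: algebra_simps del: laguerre_poly.simps)
  then show ?case by blast
qed

lemma laguerre_operator_symmetric:
  assumes "\<alpha> > -1"
  shows "laguerre_integral \<alpha> (laguerre_operator \<alpha> p * q) =
    laguerre_integral \<alpha> (p * laguerre_operator \<alpha> q)"
proof -
  have "laguerre_operator \<alpha> p * q - p * laguerre_operator \<alpha> q =
      [:0, 1:] * pderiv (pderiv p * q - p * pderiv q) +
      [:\<alpha> + 1, -1:] * (pderiv p * q - p * pderiv q)"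
    by (simp add: laguerre_operator_def pderiv_diff pderiv_mult algebra_simps)
  then have "laguerre_integral \<alpha> (laguerre_operator \<alpha> p * q - p * laguerre_operator \<alpha> q) = 0"
    using laguerre_integral_by_parts[OF assms, of "pderiv p * q - p * pderiv q"] by simp
  then show ?thesis
    by (simp add: laguerre_integral_diff assms)
qed

lemma laguerre_poly_orthogonal:
  assumes "\<alpha> > -1" "j \<noteq> k"
  shows "laguerre_integral \<alpha> (laguerre_poly \<alpha> j * laguerre_poly \<alpha> k) = 0"
  using laguerre_operator_symmetric[OF assms(1), of "laguerre_poly \<alpha> j" "laguerre_poly \<alpha> k"] assms(2)
  by (simp add: laguerre_operator_eigen laguerre_integral_minus laguerre_integral_smult)

definition laguerre_sqnorm :: "real \<Rightarrow> nat \<Rightarrow> real" where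
  "laguerre_sqnorm \<alpha> k = laguerre_integral \<alpha> ((laguerre_poly \<alpha> k)\<^sup>2)"

lemma laguerre_sqnorm_pos:
  assumes "\<alpha> > -1"
  shows "laguerre_sqnorm \<alpha> k > 0"
proof -
  have "laguerre_poly \<alpha> k \<noteq> 0"
    using coeff_laguerre_poly_nz[of \<alpha> k] by auto
  then show ?thesis
    using laguerre_norm_poly_pos[OF assms] laguerre_norm_poly[of \<alpha> "laguerre_poly \<alpha> k"]
    by (metis laguerre_sqnorm_def zero_less_power)
qed

text \<open>
  Raising and lowering are adjoint up to a scalar: applying the raising recursion to one factor of
  \<open>L\<^bsub>k+1\<^esub>\<^sup>2\<close> and integrating by parts moves \<open>x d/dx\<close> to the other factor, where it lowers
  \<open>L\<^bsub>k+1\<^esub>\<close> to a multiple of \<open>L\<^sub>k\<close> modulo \<open>L\<^bsub>k+1\<^esub>\<close>. The mixed terms vanish by orthogonality.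
\<close>

lemma laguerre_sqnorm_Suc:
  assumes "\<alpha> > -1"
  shows "(real k + 1) * laguerre_sqnorm \<alpha> (Suc k) = (real k + 1 + \<alpha>) * laguerre_sqnorm \<alpha> k"
proof -
  let ?L = "laguerre_poly \<alpha> k" and ?M = "laguerre_poly \<alpha> (Suc k)"
  have raise: "smult (real k + 1) ?M = [:0, 1:] * pderiv ?L + [:\<alpha> + 1, -1:] * ?L + smult (real k) ?L"
    unfolding laguerre_poly_raising by (rule poly_eq_poly_eq_iff[THEN iffD1], rule ext) (simp add: algebra_simps)
  have "smult (real k + 1) (?M\<^sup>2) = smult (real k + 1) ?M * ?M"
    by (simp add: power2_eq_square del: laguerre_poly.simps)
  also have "\<dots> = [:0, 1:] * pderiv (?L * ?M) + [:\<alpha> + 1, -1:] * (?L * ?M)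
      - ?L * ([:0, 1:] * pderiv ?M) + smult (real k) (?L * ?M)"
    unfolding raise by (simp add: pderiv_mult algebra_simps del: laguerre_poly.simps)
  also have "\<dots> = [:0, 1:] * pderiv (?L * ?M) + [:\<alpha> + 1, -1:] * (?L * ?M)
      + smult (real k + 1 + \<alpha>) (?L\<^sup>2) - smult 1 (?L * ?M)"
    unfolding laguerre_poly_lowering
    by (rule poly_eq_poly_eq_iff[THEN iffD1], rule ext)
       (simp add: algebra_simps power2_eq_square del: laguerre_poly.simps)
  finally have "smult (real k + 1) (?M\<^sup>2) = \<dots>" .
  then have "laguerre_integral \<alpha> (smult (real k + 1) (?M\<^sup>2)) = laguerre_integral \<alpha> \<dots>"
    by (rule arg_cong)
  then show ?thesis
    using laguerre_integral_by_parts[OF assms, of "?L * ?M"]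
      laguerre_poly_orthogonal[OF assms, of k "Suc k"]
    by (simp add: laguerre_integral_diff laguerre_integral_add laguerre_integral_smult assms
        laguerre_sqnorm_def del: laguerre_poly.simps mult_pCons_left)
qed

lemma laguerre_parseval:
  assumes "\<alpha> > -1" "finite A"
  shows "laguerre_integral \<alpha> ((\<Sum>k\<in>A. smult (c k) (laguerre_poly \<alpha> k))\<^sup>2) =
    (\<Sum>k\<in>A. laguerre_sqnorm \<alpha> k * (c k)\<^sup>2)"
proof -
  have "laguerre_integral \<alpha> ((\<Sum>k\<in>A. smult (c k) (laguerre_poly \<alpha> k))\<^sup>2) =
      (\<Sum>i\<in>A. \<Sum>j\<in>A. c i * c j * laguerre_integral \<alpha> (laguerre_poly \<alpha> i * laguerre_poly \<alpha> j))"
    by (simp add: power2_eq_square sum_product laguerre_integral_sum laguerre_integral_smult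
        assms(1) mult.assoc mult.left_commute)
  also have "\<dots> = (\<Sum>i\<in>A. \<Sum>j\<in>A. if j = i then laguerre_sqnorm \<alpha> i * (c i)\<^sup>2 else 0)"
    by (intro sum.cong refl)
       (auto simp: laguerre_poly_orthogonal assms(1) laguerre_sqnorm_def power2_eq_square)
  also have "\<dots> = (\<Sum>k\<in>A. laguerre_sqnorm \<alpha> k * (c k)\<^sup>2)"
    using assms(2) by simp
  finally show ?thesis .
qed

lemma pderiv_laguerre_expansion:
  "pderiv (\<Sum>k\<le>n. smult (c k) (laguerre_poly \<alpha> k)) =
     (\<Sum>j<n. smult (- (\<Sum>k\<in>{j<..n}. c k)) (laguerre_poly \<alpha> j))"
proof (induction n)
  case 0
  then show ?case by simp
next
  case (Suc n)
  have "(\<Sum>k\<in>{j<..Suc n}. c k) = (\<Sum>k\<in>{j<..n}. c k) + c (Suc n)" if "j \<le> n" for j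
  proof -
    have "{j<..Suc n} = insert (Suc n) {j<..n}"
      using that by auto
    then show ?thesis by simp
  qed
  then have "(\<Sum>j<Suc n. smult (- (\<Sum>k\<in>{j<..Suc n}. c k)) (laguerre_poly \<alpha> j)) =
      (\<Sum>j<Suc n. smult (- (\<Sum>k\<in>{j<..n}. c k)) (laguerre_poly \<alpha> j) - smult (c (Suc n)) (laguerre_poly \<alpha> j))"
    by (intro sum.cong refl) (simp add: smult_add_left smult_diff_left)
  moreover have "smult (c (Suc n)) (- (\<Sum>j<Suc n. laguerre_poly \<alpha> j)) =
      - (\<Sum>j<Suc n. smult (c (Suc n)) (laguerre_poly \<alpha> j))"
    by (rule poly_eq_poly_eq_iff[THEN iffD1], rule ext)
       (simp only: poly_smult poly_minus poly_sum sum_distrib_left mult_minus_right)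
  ultimately show ?case
    using Suc.IH
    by (simp add: pderiv_add pderiv_smult pderiv_laguerre_poly sum_subtractf
        del: laguerre_poly.simps)
qed

section \<open>A weighted discrete Hardy inequality\<close>

text \<open>
  For any \<open>t > 0\<close>, completing the square gives
  \<open>(x - y)\<^sup>2 \<ge> (1 - t) x\<^sup>2 - (1 / t - 1) y\<^sup>2\<close>. Summed over consecutive pairs, with \<open>t\<close>
  the ratio of consecutive values of a supersolution, the coefficient collected at each \<open>s\<^sub>j\<^sup>2\<close> is at
  least \<open>\<mu> h\<^sub>j\<close>. At the right end \<open>t n = 0\<close> is admitted, since \<open>s n = 0\<close> removes the term
  with \<open>1 / t n\<close>; at the left end \<open>t 0 = 1\<close> expresses that there is no
  incoming flux.
\<close>

lemma weighted_discrete_hardy: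
  fixes h t s :: "nat \<Rightarrow> real" and \<mu> :: real
  assumes h: "\<And>k. h k \<ge> 0"
    and t0: "t 0 = 1" and tpos: "\<And>k. k < n \<Longrightarrow> t k > 0" and tn: "t n \<ge> 0"
    and sn: "s n = 0"
    and super: "\<And>j. j < n \<Longrightarrow> \<mu> * h j \<le> h (Suc j) * (1 - t (Suc j)) - h j * (1 / t j - 1)"
  shows "\<mu> * (\<Sum>j<n. h j * (s j)\<^sup>2) \<le> (\<Sum>j<n. h (Suc j) * (s j - s (Suc j))\<^sup>2)"
proof -
  define f where "f j = h j * (1 / t j - 1) * (s j)\<^sup>2" for j
  have "\<mu> * (h j * (s j)\<^sup>2) + (f j - f (Suc j)) \<le> h (Suc j) * (s j - s (Suc j))\<^sup>2"
    if "j < n" for j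
  proof -
    have square: "(1 - t (Suc j)) * (s j)\<^sup>2 - (1 / t (Suc j) - 1) * (s (Suc j))\<^sup>2
        \<le> (s j - s (Suc j))\<^sup>2"
    proof (cases "Suc j = n")
      case True
      then show ?thesis using sn tn by (simp add: mult_left_le_one_le algebra_simps)
    next
      case False
      then have t: "t (Suc j) > 0" using tpos that by simp
      have "(s j - s (Suc j))\<^sup>2 - ((1 - t (Suc j)) * (s j)\<^sup>2 - (1 / t (Suc j) - 1) * (s (Suc j))\<^sup>2)
          = (t (Suc j) * s j - s (Suc j))\<^sup>2 / t (Suc j)"
        using t by (simp add: field_simps power2_eq_square)
      moreover have "\<dots> \<ge> 0" using t by simp
      ultimately show ?thesis by linarith
    qed
    have "\<mu> * (h j * (s j)\<^sup>2) \<le> (h (Suc j) * (1 - t (Suc j)) - h j * (1 / t j - 1)) * (s j)\<^sup>2"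
      using mult_right_mono[OF super[OF that], of "(s j)\<^sup>2"] by (simp add: mult.assoc)
    also have "\<dots> = h (Suc j) * ((1 - t (Suc j)) * (s j)\<^sup>2 - (1 / t (Suc j) - 1) * (s (Suc j))\<^sup>2)
        - (f j - f (Suc j))"
      by (simp add: f_def algebra_simps)
    also have "\<dots> \<le> h (Suc j) * (s j - s (Suc j))\<^sup>2 - (f j - f (Suc j))"
      using mult_left_mono[OF square h] by simp
    finally show ?thesis by simp
  qed
  then have "(\<Sum>j<n. \<mu> * (h j * (s j)\<^sup>2) + (f j - f (Suc j))) \<le>
      (\<Sum>j<n. h (Suc j) * (s j - s (Suc j))\<^sup>2)"
    by (intro sum_mono) simp
  moreover have "(\<Sum>j<n. f j - f (Suc j)) = 0"
    unfolding sum_lessThan_telescope' by (simp add: f_def t0 sn)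
  ultimately show ?thesis
    by (simp add: sum.distrib sum_distrib_left)
qed

section \<open>The supersolution\<close>

text \<open>
  This is the supersolution condition with its denominators cleared. The distance
  \<open>m = n - j - 1\<close> to the right end is the variable in which every coefficient becomes
  nonnegative.
\<close>

lemma supersolution_polynomial_inequality:
  fixes j n b :: real
  defines "D \<equiv> 2 * (n + 1) * (n + 3 + 3 * b / 4)"
  defines "P \<equiv> (n - j) * (n + j + 1)"
  assumes "0 \<le> j" "j + 1 \<le> n" "0 \<le> b"
  shows "(b\<^sup>2 + 8 * b - 1) * P * (D + b * (j + 1)) \<le>
    2 * b * (P * b + 2 * D) * (D - j * (j + 1)) - 4 * b * j\<^sup>2 * (D + b * (j + 1))"
proof -
  define m where "m = n - j - 1"
  have m: "m \<ge> 0" and n: "n = j + 1 + m"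
    using assms by (simp_all add: m_def)
  have "2 * b * (P * b + 2 * D) * (D - j * (j + 1)) - 4 * b * j\<^sup>2 * (D + b * (j + 1))
      - (b\<^sup>2 + 8 * b - 1) * P * (D + b * (j + 1)) =
    (4*j^3*m + 4*j^3 + 10*j^2*m^2 + 38*j^2*m + 28*j^2 + 8*j*m^3 + 52*j*m^2 + 100*j*m + 56*j
      + 2*m^4 + 18*m^3 + 56*m^2 + 72*m + 32)
    + b * (56*j^3 + 165*j^2*m + 437*j^2 + 315/2*j*m^2 + 1669/2*j*m + 1037*j
      + 99/2*m^3 + 785/2*m^2 + 975*m + 776)
    + b^2 * (8*j^3 + 8*j^2*m^2 + 48*j^2*m + 138*j^2 + 8*j*m^3 + 78*j*m^2 + 324*j*m + 416*j
      + 2*m^4 + 30*m^3 + 180*m^2 + 432*m + 352)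
    + b^3 * (j^2*m + 10*j^2 + 7/2*j*m^2 + 53/2*j*m + 41*j + 3/2*m^3 + 31/2*m^2 + 45*m + 40)"
    unfolding D_def P_def n by (simp add: field_simps) algebra
  moreover have "\<dots> \<ge> 0"
    using m assms by (intro add_nonneg_nonneg mult_nonneg_nonneg zero_le_power) auto
  ultimately show ?thesis by linarith
qed

text \<open>
  The ratio \<open>u\<^sub>k / u\<^bsub>k-1\<^esub>\<close> for \<open>u\<^sub>k = (n - k) (n + k + 1) \<Prod>\<^bsub>i\<le>k\<^esub> (1 + b i / D)\<^sup>-\<^sup>1\<close>. The first
  two factors discretise \<open>1 - x\<^sup>2\<close>, and since \<open>D\<close> is about \<open>2 n\<^sup>2\<close> the product is about
  \<open>exp (- b k\<^sup>2 / (4 n\<^sup>2))\<close>. The lower order terms of \<open>D\<close> are those for which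
  the bound to be proved is \<open>\<mu> = (b\<^sup>2 + 8 b - 1) / (2 D)\<close>. The inverse
  \<open>(1 + b i / D)\<^sup>-\<^sup>1\<close> is preferred to \<open>1 - b i / D\<close> because it stays positive when \<open>b\<close> is large
  compared with \<open>n\<close>.
\<close>

definition supersolution_ratio :: "real \<Rightarrow> real \<Rightarrow> real \<Rightarrow> real" where
  "supersolution_ratio n b k =
     (let D = 2 * (n + 1) * (n + 3 + 3 * b / 4)
      in ((n - k) * (n + k + 1)) / ((n - k + 1) * (n + k)) * (D / (D + b * k)))"

lemma supersolution_ratio_0:
  assumes "n > 0" "b \<ge> 0"
  shows "supersolution_ratio n b 0 = 1"
proof -
  have "n + 3 + 3 * b / 4 > 0"
    using assms by simp
  then show ?thesis
    using assms by (simp add: supersolution_ratio_def Let_def del: distrib_left_numeral)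
qed

lemma supersolution_ratio_pos:
  assumes "0 \<le> k" "k < n" "b \<ge> 0"
  shows "supersolution_ratio n b k > 0"
  using assms unfolding supersolution_ratio_def Let_def
  by (intro mult_pos_pos divide_pos_pos add_pos_nonneg) auto

text \<open>
  The supersolution condition divided by \<open>h\<^sub>j\<close> and multiplied by \<open>j + 1\<close>, where
  \<open>(j + 1) h\<^bsub>j+1\<^esub> / h\<^sub>j = j + b\<close>.
\<close>

lemma supersolution_inequality:
  fixes j n b :: real
  assumes "0 \<le> j" "j + 1 \<le> n" "0 \<le> b"
  shows "(b\<^sup>2 + 8 * b - 1) / (4 * (n + 1) * (n + 3 + 3 * b / 4)) * (j + 1) \<le>
    (j + b) * (1 - supersolution_ratio n b (j + 1))
      - (j + 1) * (1 / supersolution_ratio n b j - 1)"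
proof -
  define D where "D = 2 * (n + 1) * (n + 3 + 3 * b / 4)"
  define P where "P = (n - j) * (n + j + 1)"
  define E where "E = P * b + 2 * D"
  define D' where "D' = D + b * (j + 1)"
  define K where "K = b\<^sup>2 + 8 * b - 1"
  have M: "4 * (n + 1) * (n + 3 + 3 * b / 4) = 2 * D"
    by (simp add: D_def)
  have pos: "D > 0" "P > 0" "D' > 0" "D + b * j > 0"
    using assms by (auto simp: D_def P_def D'_def intro!: mult_pos_pos add_pos_nonneg)
  have "supersolution_ratio n b (j + 1) = (P - 2 * (j + 1)) / P * (D / D')"
    unfolding supersolution_ratio_def Let_def D_def[symmetric] D'_def P_def
    by (simp add: algebra_simps)
  then have right: "1 - supersolution_ratio n b (j + 1) = (j + 1) * E / (P * D')"
    using pos by (simp add: field_simps E_def) (simp add: D'_def algebra_simps)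
  have "supersolution_ratio n b j = P / (P + 2 * j) * (D / (D + b * j))"
    unfolding supersolution_ratio_def Let_def D_def[symmetric] P_def
    by (simp add: algebra_simps)
  then have inv: "1 / supersolution_ratio n b j = (P + 2 * j) * (D + b * j) / (P * D)"
    by simp
  have left: "1 / supersolution_ratio n b j - 1 = j * (E + 2 * b * j) / (P * D)"
    unfolding inv using pos by (simp add: divide_simps E_def) (simp add: algebra_simps)
  have "0 \<le> 2 * b * E * (D - j * (j + 1)) - 4 * b * j\<^sup>2 * D' - K * P * D'"
    using supersolution_polynomial_inequality[OF assms]
    by (simp add: D_def P_def E_def D'_def K_def)
  also have "\<dots> = 2 * D * (j + b) * E - 2 * j * (E + 2 * b * j) * D' - K * P * D'"
    by (simp add: D'_def algebra_simps power2_eq_square)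
  finally have "0 \<le> (j + 1) * (\<dots> / (2 * P * D * D'))"
    using pos assms by (intro mult_nonneg_nonneg divide_nonneg_pos) auto
  also have "\<dots> = (j + b) * ((j + 1) * E / (P * D')) - (j + 1) * (j * (E + 2 * b * j) / (P * D))
      - K / (2 * D) * (j + 1)"
    using pos by (simp add: divide_simps) (simp add: algebra_simps)
  finally show ?thesis
    unfolding left right M K_def[symmetric] by simp
qed

section \<open>The Markov inequality\<close>

lemma markov_inequality_laguerre:
  fixes p :: "real poly"
  assumes "\<alpha> > -1" "n \<ge> 1" "degree p \<le> n"
  shows "(\<alpha>\<^sup>2 + 10 * \<alpha> + 8) / (4 * (real n + 1) * (real n + 3 + 3 * (\<alpha> + 1) / 4)) *
    (laguerre_norm \<alpha> (poly (pderiv p)))\<^sup>2 \<le> (laguerre_norm \<alpha> (poly p))\<^sup>2"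
proof -
  define \<mu> where "\<mu> = (\<alpha>\<^sup>2 + 10 * \<alpha> + 8) / (4 * (real n + 1) * (real n + 3 + 3 * (\<alpha> + 1) / 4))"
  define h where "h = laguerre_sqnorm \<alpha>"
  define t where "t k = supersolution_ratio n (\<alpha> + 1) (real k)" for k
  have hpos: "h k > 0" for k
    using laguerre_sqnorm_pos[OF assms(1)] by (simp add: h_def)
  obtain c where p: "p = (\<Sum>k\<le>n. smult (c k) (laguerre_poly \<alpha> k))"
    using laguerre_expansion[OF assms(3)] by blast
  define s where "s j = (\<Sum>k\<in>{j<..n}. c k)" for j
  have c: "c (Suc j) = s j - s (Suc j)" if "j < n" for j
  proof -
    have "{j<..n} = insert (Suc j) {Suc j<..n}"
      using that by auto
    then show ?thesis by (simp add: s_def)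
  qed
  have "\<mu> * (\<Sum>j<n. h j * (s j)\<^sup>2) \<le> (\<Sum>j<n. h (Suc j) * (s j - s (Suc j))\<^sup>2)"
  proof (rule weighted_discrete_hardy[where t = t])
    show "h k \<ge> 0" for k
      using hpos[of k] by simp
    show "t 0 = 1"
      using assms by (simp add: t_def supersolution_ratio_0)
    show "t k > 0" if "k < n" for k
      using assms that by (simp add: t_def supersolution_ratio_pos)
    show "t n \<ge> 0"
      by (simp add: t_def supersolution_ratio_def)
    show "s n = 0"
      by (simp add: s_def)
    show "\<mu> * h j \<le> h (Suc j) * (1 - t (Suc j)) - h j * (1 / t j - 1)" if "j < n" for j
    proof -
      have "\<mu> * (real j + 1) \<le>
          (real j + (\<alpha> + 1)) * (1 - t (Suc j)) - (real j + 1) * (1 / t j - 1)"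
      proof -
        have "(\<alpha> + 1)\<^sup>2 + 8 * (\<alpha> + 1) - 1 = \<alpha>\<^sup>2 + 10 * \<alpha> + 8"
          by (simp add: power2_eq_square algebra_simps)
        then show ?thesis
          using supersolution_inequality[of "real j" "real n" "\<alpha> + 1"] that assms(1)
          by (simp add: \<mu>_def t_def add.commute)
      qed
      from mult_right_mono[OF this, of "h j"]
      have "(real j + 1) * (\<mu> * h j) \<le>
          ((real j + 1 + \<alpha>) * h j) * (1 - t (Suc j)) - (real j + 1) * (h j * (1 / t j - 1))"
        using hpos[of j] by (simp add: algebra_simps)
      also have "(real j + 1 + \<alpha>) * h j = (real j + 1) * h (Suc j)"
        using laguerre_sqnorm_Suc[OF assms(1)] by (simp add: h_def)
      finally have "(real j + 1) * (\<mu> * h j) \<le>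
          (real j + 1) * (h (Suc j) * (1 - t (Suc j)) - h j * (1 / t j - 1))"
        by (simp add: algebra_simps)
      then show ?thesis
        by (rule mult_left_le_imp_le) simp
    qed
  qed
  also have "\<dots> = (\<Sum>k<n. h (Suc k) * (c (Suc k))\<^sup>2)"
    by (intro sum.cong refl) (simp add: c)
  also have "\<dots> \<le> (\<Sum>k\<le>n. h k * (c k)\<^sup>2)"
    using hpos[of 0] by (simp add: sum.atMost_shift)
  also have "\<dots> = (laguerre_norm \<alpha> (poly p))\<^sup>2"
    by (simp add: laguerre_norm_poly p laguerre_parseval assms(1) h_def)
  finally have "\<mu> * (\<Sum>j<n. h j * (s j)\<^sup>2) \<le> (laguerre_norm \<alpha> (poly p))\<^sup>2" .
  moreover have "(laguerre_norm \<alpha> (poly (pderiv p)))\<^sup>2 = (\<Sum>j<n. h j * (s j)\<^sup>2)"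
    using laguerre_parseval[OF assms(1), of "{..<n}" "\<lambda>j. - s j"]
    by (simp add: laguerre_norm_poly p pderiv_laguerre_expansion h_def s_def)
  ultimately show ?thesis
    by (simp add: \<mu>_def)
qed

theorem theorem1p1:
  fixes n :: nat and \<alpha> :: real
  assumes "n \<ge> 3" and "\<alpha> \<ge> 2"
  shows "(markov_constant n \<alpha>)\<^sup>2 \<le>
    ereal (4 * (real n + 1) * (real n + 3 + 3 * (\<alpha> + 1) / 4) / (\<alpha>\<^sup>2 + 10 * \<alpha> + 8))"
proof -
  define M where "M = 4 * (real n + 1) * (real n + 3 + 3 * (\<alpha> + 1) / 4)"
  define K where "K = \<alpha>\<^sup>2 + 10 * \<alpha> + 8"
  have pos: "M > 0" "K > 0"
    using assms by (auto simp: M_def K_def intro!: mult_pos_pos add_nonneg_pos)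
  have quotient: "laguerre_norm \<alpha> (poly (pderiv p)) / laguerre_norm \<alpha> (poly p) \<le> sqrt (M / K)"
    if p: "degree p \<le> n" "p \<noteq> 0" for p
  proof (rule real_le_rsqrt)
    have "K / M * (laguerre_norm \<alpha> (poly (pderiv p)))\<^sup>2 \<le> (laguerre_norm \<alpha> (poly p))\<^sup>2"
      using markov_inequality_laguerre[of \<alpha> n p] p(1) assms by (simp add: M_def K_def)
    moreover have "laguerre_norm \<alpha> (poly p) > 0"
      using laguerre_norm_poly_pos[of \<alpha> p] p(2) assms by simp
    ultimately show "(laguerre_norm \<alpha> (poly (pderiv p)) / laguerre_norm \<alpha> (poly p))\<^sup>2 \<le> M / K"
      using pos by (simp add: power_divide field_simps)
  qed
  have le: "markov_constant n \<alpha> \<le> ereal (sqrt (M / K))"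
    unfolding markov_constant_def by (rule SUP_least) (use quotient in auto)
  \<comment> \<open>Squaring is monotone only on nonnegative numbers; the quotient at \<open>p = 1\<close> supplies the sign.\<close>
  have "ereal (laguerre_norm \<alpha> (poly (pderiv 1)) / laguerre_norm \<alpha> (poly 1)) \<le> markov_constant n \<alpha>"
    unfolding markov_constant_def by (rule SUP_upper) auto
  then have "0 \<le> markov_constant n \<alpha>"
    by (simp add: laguerre_norm_def zero_ereal_def)
  then have "(markov_constant n \<alpha>)\<^sup>2 \<le> (ereal (sqrt (M / K)))\<^sup>2"
    unfolding power2_eq_square using le pos by (intro ereal_mult_mono) auto
  also have "\<dots> = ereal (M / K)"
    using pos by (simp add: power2_eq_square)
  finally show ?thesis
    by (simp add: M_def K_def)
qed

end
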